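(* Let $\lambda$ be an infinite cardinal with $\lambda = \lambda^{<\lambda}$. If $\mathfrak{p}_\lambda = \lambda^+$, then $\mathfrak{t}_\lambda = \lambda^+$.
   Context: $\lambda$ is an infinite cardinal with $\lambda^{<\lambda}=\lambda$, so $\lambda$ is regular. For $A,B\subseteq\lambda$, $A\subseteq^* B$ means $|A\setminus B|<\lambda$. A family $\mathcal{F}\subseteq[\lambda]^\lambda$ has the strong intersection property if $|\bigcap\mathcal{F}'|=\lambda$ for every $\mathcal{F}'\subseteq\mathcal{F}$ with $0<|\mathcal{F}'|<\lambda$. A set $A$ is a pseudointersection of $\mathcal{F}$ if $A\subseteq^* F$ for all $F\in\mathcal{F}$. $\mathfrak{p}_\lambda$ is the least cardinality of a family $\mathcal{F}\subseteq[\lambda]^\lambda$ with the strong intersection property that has no pseudointersection of size $\lambda$. A tower in $\lambda$ is a family $\mathcal{T}\subseteq[\lambda]^\lambda$ that is well ordered by $\supseteq^*$, has the strong intersection property, and has no pseudointersection of size $\lambda$; $\mathfrak{t}_\lambda$ is the least cardinality of a tower in $\lambda$. *)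

theory Defs
  imports Main
begin

unbundle cardinal_syntax



text \<open>The cardinal lambda is represented as the cardinality of an infinite set L;
  subsets of lambda are subsets of L, and cardinalities are compared with the
  cardinal-order relations of the BNF cardinal library (card_of, ordLess, ordIso,
  cardSuc).\<close>

definition almost_sub :: "'a set \<Rightarrow> 'a set \<Rightarrow> 'a set \<Rightarrow> bool" where
  "almost_sub L A B \<longleftrightarrow> card_of (A - B) <o card_of (L)"

definition full_size :: "'a set \<Rightarrow> 'a set \<Rightarrow> bool" where
  "full_size L A \<longleftrightarrow> A \<subseteq> L \<and> card_of (A) =o card_of (L)"

definition strong_intersection_property :: "'a set \<Rightarrow> 'a set set \<Rightarrow> bool" where
  "strong_intersection_property L F \<longleftrightarrow>
     (\<forall>A\<in>F. full_size L A) \<and>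
     (\<forall>F'. F' \<subseteq> F \<and> F' \<noteq> {} \<and> card_of F' <o card_of (L) \<longrightarrow> card_of (\<Inter>F') =o card_of (L))"

definition pseudointersection :: "'a set \<Rightarrow> 'a set set \<Rightarrow> 'a set \<Rightarrow> bool" where
  "pseudointersection L F A \<longleftrightarrow> (\<forall>X\<in>F. almost_sub L A X)"

definition p_family :: "'a set \<Rightarrow> 'a set set \<Rightarrow> bool" where
  "p_family L F \<longleftrightarrow> strong_intersection_property L F \<and>
     \<not> (\<exists>A. full_size L A \<and> pseudointersection L F A)"

definition tower :: "'a set \<Rightarrow> 'a set set \<Rightarrow> bool" where
  "tower L T \<longleftrightarrow> p_family L T \<and>
     (\<exists>r. Well_order r \<and> Field r = T \<and> (\<forall>x y. (x, y) \<in> r \<longrightarrow> almost_sub L y x))"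

definition lambda_lt_lambda_eq :: "'a set \<Rightarrow> bool" where
  "lambda_lt_lambda_eq L \<longleftrightarrow> (\<forall>M. M \<subseteq> L \<and> card_of (M) <o card_of (L) \<longrightarrow> card_of (Func M L) \<le>o card_of (L))"

definition least_card_is :: "('a set set \<Rightarrow> bool) \<Rightarrow> 'b rel \<Rightarrow> bool" where
  "least_card_is P k \<longleftrightarrow> (\<exists>F. P F \<and> card_of (F) =o k) \<and> (\<forall>F. P F \<longrightarrow> \<not> card_of (F) <o k)"

abbreviation p_lambda_is where "p_lambda_is L k \<equiv> least_card_is (p_family L) k"
abbreviation t_lambda_is where "t_lambda_is L k \<equiv> least_card_is (tower L) k"

end

theory Submission
  imports Defs
begin

text \<open>
  Let \<open>F \<beta>\<close>, \<open>\<beta> < \<lambda>\<^sup>+\<close>, have the strong intersection property but no pseudointersection, and suppose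
  that there is no tower of size at most \<open>\<lambda>\<^sup>+\<close>. A sequence that decreases modulo small sets cannot be
  continued naively at limits of cofinality less than \<open>\<lambda>\<close>, so it is read off from index sets:
  choose \<open>B \<alpha> \<xi> \<in> [\<lambda>\<^sup>+]\<^bsup><\<lambda>\<^esup>\<close> containing \<open>\<alpha>\<close>, growing with \<open>\<xi> < \<lambda>\<close> and, for all large \<open>\<xi>\<close>,
  with \<open>\<alpha> < \<lambda>\<^sup>+\<close>. Then \<open>S \<alpha> \<xi> = (\<Inter>\<beta>\<in>B \<alpha> \<xi>. F \<beta>) - \<xi>\<close> is never empty. The functions
  \<open>\<xi> \<mapsto> min (S \<alpha> \<xi>)\<close> increase with \<open>\<alpha>\<close> modulo bounded sets, and they have a common dominating function
  \<open>g\<close>: a pseudointersection of a decreasing sequence of sets sparse for these functions yields one.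
  The sets \<open>T \<alpha> = (\<Union>\<xi>. S \<alpha> \<xi> \<inter> g \<xi>)\<close> are unbounded, decrease modulo small sets and satisfy
  \<open>T \<alpha> \<subseteq> F \<alpha>\<close>, so a pseudointersection of them is one of \<open>F\<close>, a contradiction.
\<close>

section \<open>Small sets and regularity of \<open>\<lambda>\<close>\<close>

locale lambda_power =
  fixes L :: "'a set"
  assumes infinite_L: "infinite L"
    and power_L: "lambda_lt_lambda_eq L"
begin

abbreviation small :: "'b set \<Rightarrow> bool" where
  "small X \<equiv> |X| <o |L|"

abbreviation le (infix "\<preceq>" 50) where "x \<preceq> y \<equiv> (x, y) \<in> |L|"

abbreviation lt (infix "\<prec>" 50) where "x \<prec> y \<equiv> x \<preceq> y \<and> x \<noteq> y"

abbreviation K :: "'a set rel" where "K \<equiv> cardSuc |L|"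

lemma small_mono: "A \<subseteq> B \<Longrightarrow> small B \<Longrightarrow> small A"
  using card_of_mono1 ordLeq_ordLess_trans by blast

lemma small_image: "small A \<Longrightarrow> small (f ` A)"
  using card_of_image ordLeq_ordLess_trans by blast

lemma not_small_iff: "\<not> small A \<longleftrightarrow> |L| \<le>o |A|"
  by (rule not_ordLess_iff_ordLeq[OF card_of_Well_order card_of_Well_order])

lemma small_finite: "finite A \<Longrightarrow> small A"
  using card_of_ordLeq_finite[of L A] infinite_L not_small_iff[of A] by blast

lemma not_small_L: "\<not> small L"
  using ordLess_irreflexive by blast

text \<open>Regularity of \<open>\<lambda>\<close>, by Koenig's diagonal argument.\<close>

lemma small_UN:
  assumes I: "small I" and A: "\<And>i. i \<in> I \<Longrightarrow> small (A i)"
  shows "small (\<Union>i\<in>I. A i)"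
proof (rule ccontr)
  assume "\<not> small (\<Union>i\<in>I. A i)"
  then have large: "|L| \<le>o |\<Union>i\<in>I. A i|"
    by (simp only: not_small_iff)
  \<comment> \<open>The hypothesis \<open>power_L\<close> concerns exponents inside
    \<open>L\<close>, so \<open>I\<close> is first copied there.\<close>
  obtain j where j: "inj_on j I" "j ` I \<subseteq> L"
    using ordLess_imp_ordLeq[OF I] card_of_ordLeq[of I L] by blast
  have "|Func (j ` I) L| \<le>o |L|"
    using power_L[unfolded lambda_lt_lambda_eq_def, rule_format, of "j ` I"] j(2) small_image[OF I, of j]
    by simp
  then have "|Func (j ` I) L| \<le>o |\<Union>i\<in>I. A i|"
    using large by (rule ordLeq_transitive)
  moreover have "Func (j ` I) L \<noteq> {}"
    using Func_non_emp infinite_L by (metis finite.emptyI)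
  ultimately obtain \<psi> where \<psi>: "\<psi> ` (\<Union>i\<in>I. A i) = Func (j ` I) L"
    using card_of_ordLeq2 by metis
  \<comment> \<open>As \<open>A i\<close> is small, the functions listed by \<open>A i\<close> miss
    some value \<open>d i\<close> at the coordinate \<open>j i\<close>. The function
    \<open>G\<close> assembled from these values differs from every listed one.\<close>
  have "\<exists>d\<in>L. d \<notin> (\<lambda>x. \<psi> x (j i)) ` A i" if "i \<in> I" for i
    using small_mono[OF _ small_image[OF A[OF that]], of L "\<lambda>x. \<psi> x (j i)"] not_small_L by blast
  then obtain d where d: "\<And>i. i \<in> I \<Longrightarrow> d i \<in> L \<and> d i \<notin> (\<lambda>x. \<psi> x (j i)) ` A i"
    by metis
  define G where "G y = (if y \<in> j ` I then d (the_inv_into I j y) else undefined)" for y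
  have Gj: "G (j i) = d i" if "i \<in> I" for i
    using that by (simp add: G_def the_inv_into_f_f[OF j(1)])
  have "G \<in> Func (j ` I) L"
    using Gj d unfolding Func_def by (auto simp: G_def)
  then obtain i x where "i \<in> I" "x \<in> A i" "\<psi> x = G"
    using \<psi> by (metis (no_types, lifting) UN_E imageE)
  then have "d i = \<psi> x (j i)"
    using Gj by simp
  then show False
    using d \<open>i \<in> I\<close> \<open>x \<in> A i\<close> by blast
qed

lemma small_Un:
  assumes "small A" "small B"
  shows "small (A \<union> B)"
proof -
  have "small (\<Union>b\<in>UNIV. if b then A else B)"
    by (rule small_UN) (use assms in \<open>auto intro: small_finite\<close>)
  then show ?thesis
    by (rule small_mono[rotated]) (auto split: if_splits)
qed

section \<open>Bounded and unbounded subsets of \<open>L\<close>\<close>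

lemma wo_L: "wo_rel |L|"
  by (simp add: wo_rel_def card_of_Well_order)

lemma le_dom: "x \<preceq> y \<Longrightarrow> x \<in> L \<and> y \<in> L"
  by (metis FieldI1 FieldI2 Field_card_of)

lemma le_refl: "x \<in> L \<Longrightarrow> x \<preceq> x"
  using wo_rel.REFL[OF wo_L] by (simp add: refl_on_def Field_card_of)

lemma le_trans: "x \<preceq> y \<Longrightarrow> y \<preceq> z \<Longrightarrow> x \<preceq> z"
  using wo_rel.TRANS[OF wo_L] by (meson transD)

lemma le_antisym: "x \<preceq> y \<Longrightarrow> y \<preceq> x \<Longrightarrow> x = y"
  using wo_rel.ANTISYM[OF wo_L] by (meson antisymD)

lemma le_total: "x \<in> L \<Longrightarrow> y \<in> L \<Longrightarrow> x \<preceq> y \<or> y \<prec> x"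
  using wo_rel.TOTALS[OF wo_L] le_refl by (metis Field_card_of)

lemma least_exists:
  assumes "X \<subseteq> L" "X \<noteq> {}"
  shows "\<exists>m\<in>X. \<forall>x\<in>X. m \<preceq> x"
  using wo_rel.minim_in[OF wo_L, of X] wo_rel.minim_least[OF wo_L, of X] assms
  by (auto simp: Field_card_of)

lemma small_below: "small {x. x \<preceq> y}"
proof (cases "y \<in> L")
  case True
  have "small (underS |L| y)"
    using card_of_underS[OF card_of_Card_order, of y L] True by (simp add: Field_card_of)
  then have "small (underS |L| y \<union> {y})"
    using small_Un small_finite[of "{y}"] by blast
  then show ?thesis
    by (rule small_mono[rotated]) (auto simp: underS_def)
next
  case False
  then have "{x. x \<preceq> y} = {}"
    using le_dom[of _ y] by blast
  then show ?thesis
    using small_finite by (metis finite.emptyI)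
qed

text \<open>By regularity, fewer than \<open>\<lambda>\<close> small initial segments cannot exhaust
  \<open>L\<close>.\<close>

lemma small_bounded:
  assumes "small X"
  shows "\<exists>b\<in>L. \<forall>x\<in>X \<inter> L. x \<prec> b"
proof -
  have "small (\<Union>x\<in>X. {y. y \<preceq> x})"
    using assms small_below by (rule small_UN)
  then obtain b where b: "b \<in> L" "b \<notin> (\<Union>x\<in>X. {y. y \<preceq> x})"
    using not_small_L small_mono[of L "\<Union>x\<in>X. {y. y \<preceq> x}"] by blast
  have "x \<prec> b" if "x \<in> X \<inter> L" for x
    using b that le_total[of b x] by blast
  then show ?thesis
    using b by blast
qed

lemma full_size_iff: "full_size L A \<longleftrightarrow> A \<subseteq> L \<and> \<not> small A"
  unfolding full_size_def
  by (metis card_of_mono1 not_ordLess_ordIso ordLeq_iff_ordLess_or_ordIso)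

lemma full_size_unbounded:
  assumes "\<not> small A" "A \<subseteq> L" "b \<in> L"
  shows "\<exists>a\<in>A. b \<prec> a"
proof -
  obtain a where "a \<in> A" "\<not> a \<preceq> b"
    using assms(1) small_mono[OF _ small_below[of b]] by blast
  then show ?thesis
    using le_total[of a b] assms by blast
qed

lemma unbounded_not_small:
  assumes "\<And>b. b \<in> L \<Longrightarrow> \<exists>a\<in>A. b \<preceq> a"
  shows "\<not> small A"
proof
  assume "small A"
  then obtain b where b: "b \<in> L" "\<forall>x\<in>A \<inter> L. x \<prec> b"
    using small_bounded[of A] by blast
  then obtain a where a: "a \<in> A" "b \<preceq> a"
    using assms by blast
  then have "a \<prec> b"
    using b le_dom[of b a] by blast
  then show False
    using a le_antisym[of a b] by blast
qed

section \<open>The successor cardinal \<open>K\<close>\<close>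

lemma wo_K: "wo_rel K"
  by (simp add: wo_rel_def cardSuc_Card_order card_of_Card_order Card_order_wo_rel[unfolded wo_rel_def])

lemma K_refl: "\<alpha> \<in> Field K \<Longrightarrow> (\<alpha>, \<alpha>) \<in> K"
  using wo_rel.REFL[OF wo_K] by (simp add: refl_on_def)

lemma underS_K_le: "\<alpha> \<in> Field K \<Longrightarrow> |underS K \<alpha>| \<le>o |L|"
  using card_of_underS[OF cardSuc_Card_order[OF card_of_Card_order]]
    cardSuc_ordLeq_ordLess[OF card_of_Card_order card_of_Card_order] by blast

lemma Field_K_ordIso: "|Field K| =o K"
  by (simp add: card_of_Field_ordIso cardSuc_Card_order card_of_Card_order)

text \<open>If \<open>J\<close> were unbounded, \<open>Field K\<close> would be covered by fewer
  than \<open>\<lambda>\<close> initial segments of size at most \<open>\<lambda>\<close>, too few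
  for a successor cardinal.\<close>

lemma K_bounded:
  assumes J: "J \<subseteq> Field K" "small J"
  shows "\<exists>\<gamma>\<in>Field K. \<forall>\<alpha>\<in>J. (\<alpha>, \<gamma>) \<in> K"
proof (rule ccontr)
  assume *: "\<not> ?thesis"
  have "\<exists>\<alpha>\<in>J. \<gamma> \<in> underS K \<alpha>" if \<gamma>: "\<gamma> \<in> Field K" for \<gamma>
  proof -
    obtain \<alpha> where \<alpha>: "\<alpha> \<in> J" "(\<alpha>, \<gamma>) \<notin> K"
      using * \<gamma> by blast
    then have "(\<gamma>, \<alpha>) \<in> K"
      using \<gamma> J(1) wo_rel.TOTALS[OF wo_K] by blast
    then show ?thesis
      using \<alpha> by (auto simp: underS_def)
  qed
  then have "Field K \<subseteq> (\<Union>\<alpha>\<in>J. underS K \<alpha>)"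
    by blast
  moreover have "|\<Union>\<alpha>\<in>J. underS K \<alpha>| \<le>o |L|"
    using J underS_K_le ordLess_imp_ordLeq[OF J(2)] infinite_L
    by (intro card_of_UNION_ordLeq_infinite) auto
  ultimately have "|Field K| \<le>o |L|"
    using ordLeq_transitive[OF card_of_mono1] by blast
  then have "K \<le>o |L|"
    using ordIso_ordLeq_trans[OF ordIso_symmetric[OF Field_K_ordIso]] by blast
  then show False
    using cardSuc_greater[OF card_of_Card_order, of L] not_ordLess_ordLeq by blast
qed

section \<open>Decreasing sequences in the absence of short towers\<close>

text \<open>Otherwise the range of \<open>T\<close> would be a tower of size at most
  \<open>K\<close>. Its strong intersection property comes from \<open>bdd\<close>: fewer than
  \<open>\<lambda>\<close> members have indices below some \<open>\<gamma>\<close>, and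
  \<open>T \<gamma>\<close> lies in their intersection up to a small set. Leaving \<open>I\<close>
  free covers proper initial segments of \<open>K\<close> as well.\<close>

lemma chain_pseudointersection:
  assumes no_tower: "\<And>T. tower L T \<Longrightarrow> \<not> |T| \<le>o K"
    and I: "I \<subseteq> Field K"
    and full: "\<And>\<alpha>. \<alpha> \<in> I \<Longrightarrow> full_size L (T \<alpha>)"
    and chain: "\<And>\<alpha> \<beta>. \<alpha> \<in> I \<Longrightarrow> \<beta> \<in> I \<Longrightarrow> \<alpha> \<in> underS K \<beta> \<Longrightarrow> small (T \<beta> - T \<alpha>)"
    and bdd: "\<And>J. J \<subseteq> I \<Longrightarrow> J \<noteq> {} \<Longrightarrow> small J \<Longrightarrow> \<exists>\<gamma>\<in>I. \<forall>\<alpha>\<in>J. (\<alpha>, \<gamma>) \<in> K"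
  shows "\<exists>A. A \<subseteq> L \<and> \<not> small A \<and> (\<forall>\<alpha>\<in>I. small (A - T \<alpha>))"
proof (rule ccontr)
  assume no: "\<not> ?thesis"
  have chain': "small (T \<beta> - T \<alpha>)" if "\<alpha> \<in> I" "\<beta> \<in> I" "(\<alpha>, \<beta>) \<in> K" for \<alpha> \<beta>
    using chain that small_finite[of "{}"] by (cases "\<alpha> = \<beta>") (auto simp: underS_def)
  \<comment> \<open>Since \<open>T\<close> may repeat values, one index per value is kept. The
    injective restriction of \<open>T\<close> to \<open>I0\<close> carries the order of
    \<open>K\<close> over to the range.\<close>
  define idx where "idx X = (SOME \<alpha>. \<alpha> \<in> I \<and> T \<alpha> = X)" for X
  have idx: "idx X \<in> I \<and> T (idx X) = X" if "X \<in> T ` I" for X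
    unfolding idx_def by (rule someI_ex) (use that in blast)
  define I0 where "I0 = idx ` (T ` I)"
  have I0: "I0 \<subseteq> I" "T ` I0 = T ` I"
    using idx by (auto simp: I0_def image_iff)
  have inj: "inj_on T I0"
    using idx by (force simp: I0_def inj_on_def)
  have sip: "strong_intersection_property L (T ` I)"
    unfolding strong_intersection_property_def
  proof (intro conjI ballI allI impI)
    show "full_size L A" if "A \<in> T ` I" for A
      using that full by blast
  next
    fix F' assume F': "F' \<subseteq> T ` I \<and> F' \<noteq> {} \<and> small F'"
    have J: "idx ` F' \<subseteq> I" "idx ` F' \<noteq> {}" "small (idx ` F')"
      using F' idx small_image by auto
    then obtain \<gamma> where \<gamma>: "\<gamma> \<in> I" "\<forall>\<alpha>\<in>idx ` F'. (\<alpha>, \<gamma>) \<in> K"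
      using bdd by meson
    have "small (T \<gamma> - X)" if "X \<in> F'" for X
      using chain'[of "idx X" \<gamma>] \<gamma> idx[of X] that F' by auto
    then have s: "small (\<Union>X\<in>F'. T \<gamma> - X)"
      using F' small_UN by blast
    have "\<not> small (\<Inter>F')"
    proof
      assume "small (\<Inter>F')"
      then have "small (\<Inter>F' \<union> (\<Union>X\<in>F'. T \<gamma> - X))"
        using s small_Un by blast
      then have "small (T \<gamma>)"
        by (rule small_mono[rotated]) blast
      then show False
        using full[OF \<gamma>(1)] full_size_iff by blast
    qed
    moreover have "\<Inter>F' \<subseteq> L"
      using F' full full_size_iff by blast
    ultimately show "|\<Inter>F'| =o |L|"
      using full_size_iff full_size_def by blast
  qed
  have "Well_order (Restr K I0)" "Field (Restr K I0) = I0"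
    using well_order_on_Well_order[OF well_order_on_Restr[of K I0]] I0(1) I wo_K
    unfolding wo_rel_def by blast+
  then have "Well_order (dir_image (Restr K I0) T)" "Field (dir_image (Restr K I0) T) = T ` I"
    using Well_order_dir_image[of "Restr K I0" T] inj I0 by (auto simp: dir_image_Field)
  moreover have "\<forall>x y. (x, y) \<in> dir_image (Restr K I0) T \<longrightarrow> almost_sub L y x"
    using chain' I0 by (auto simp: dir_image_def almost_sub_def)
  moreover have "p_family L (T ` I)"
    using sip no by (auto simp: p_family_def pseudointersection_def almost_sub_def full_size_iff)
  ultimately have "tower L (T ` I)"
    unfolding tower_def by blast
  moreover have "|T ` I| \<le>o K"
    by (rule ordLeq_transitive[OF card_of_image ordLeq_ordIso_trans[OF card_of_mono1[OF I] Field_K_ordIso]])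
  ultimately show False
    using no_tower by blast
qed

section \<open>Sparse sets and dominating functions\<close>

text \<open>Below, \<open>hit a c\<close> stands for \<open>f a \<prec> c\<close> with a monotone function \<open>f\<close>. If \<open>L\<close> is uncountable,
  the closure points of \<open>f\<close> form a club, and these clubs decrease when \<open>f\<close> increases. For countable
  \<open>L\<close> there may be no closure points, and sparse sets have to be chosen by recursion instead.\<close>

lemma closure_points_not_small:
  assumes uncountable: "small (UNIV :: nat set)"
    and hit_left: "\<And>a a' c. a \<preceq> a' \<Longrightarrow> hit a' c \<Longrightarrow> hit a c"
    and hit_right: "\<And>a c c'. hit a c \<Longrightarrow> c \<preceq> c' \<Longrightarrow> hit a c'"
    and hit_ex: "\<And>a. a \<in> L \<Longrightarrow> \<exists>c\<in>L. hit a c"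
  shows "\<not> small {c \<in> L. \<forall>a. a \<prec> c \<longrightarrow> hit a c}"
proof (rule unbounded_not_small)
  fix b assume b: "b \<in> L"
  have "\<exists>c'\<in>L. c \<prec> c' \<and> hit c c'" if "c \<in> L" for c
  proof -
    obtain d where d: "d \<in> L" "hit c d" using hit_ex \<open>c \<in> L\<close> by blast
    obtain c' where "c' \<in> L" "\<forall>x\<in>{c, d} \<inter> L. x \<prec> c'"
      using small_bounded[of "{c, d}"] small_finite[of "{c, d}"] by blast
    then show ?thesis
      using d that hit_right[of c d c'] by blast
  qed
  then obtain nx where nx: "\<And>c. c \<in> L \<Longrightarrow> nx c \<in> L \<and> c \<prec> nx c \<and> hit c (nx c)"
    by metis
  \<comment> \<open>The closure point sought is the supremum \<open>m\<close> of an
    \<open>\<omega>\<close>-sequence starting at \<open>b\<close>.\<close>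
  define s where "s n = (nx ^^ n) b" for n
  have sL: "s n \<in> L" for n
    by (induction n) (auto simp: s_def b nx)
  have sS: "s (Suc n) = nx (s n)" for n
    by (simp add: s_def)
  \<comment> \<open>Uncountability enters here: a countable sequence is bounded in
    \<open>L\<close>.\<close>
  have "\<exists>c\<in>L. \<forall>x\<in>range s \<inter> L. x \<prec> c"
    by (rule small_bounded[OF small_image[OF uncountable]])
  then have "{c \<in> L. \<forall>n. s n \<preceq> c} \<noteq> {}"
    using sL by auto
  then obtain m where m: "m \<in> L" "\<forall>n. s n \<preceq> m" and
    min: "\<And>x. x \<in> L \<Longrightarrow> \<forall>n. s n \<preceq> x \<Longrightarrow> m \<preceq> x"
    using least_exists[of "{c \<in> L. \<forall>n. s n \<preceq> c}"] by blast
  have "hit a m" if "a \<prec> m" for a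
  proof -
    have "\<not> (\<forall>n. s n \<preceq> a)"
      using min[of a] that le_antisym[of a m] le_dom[of a m] by blast
    then obtain n where "\<not> s n \<preceq> a"
      by blast
    then have "a \<preceq> s n"
      using le_total[of "s n" a] sL[of n] that le_dom[of a m] by blast
    then have "hit a (s (Suc n))"
      using nx[OF sL[of n]] sS[of n] hit_left[of a "s n"] by simp
    then show ?thesis
      using hit_right[of a "s (Suc n)" m] m by blast
  qed
  moreover have "b \<preceq> m"
    using m(2)[rule_format, of 0] by (simp add: s_def)
  ultimately show "\<exists>a\<in>{c \<in> L. \<forall>a. a \<prec> c \<longrightarrow> hit a c}. b \<preceq> a"
    using m by blast
qed

lemma countable_small_iff:
  assumes "\<not> small (UNIV :: nat set)"
  shows "small X \<longleftrightarrow> finite X"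
proof -
  have "|L| \<le>o |UNIV :: nat set|"
    using assms by (simp only: not_small_iff)
  then have "finite X" if "small X"
    using that infinite_iff_card_of_nat[of X] not_ordLess_ordLeq ordLeq_transitive by blast
  then show ?thesis
    using small_finite by blast
qed

text \<open>Elements of \<open>A\<close> are picked recursively, each beyond its predecessor
  \<open>c\<close> and beyond some \<open>d\<close> with \<open>hit c d\<close>. Then
  \<open>hit_right\<close> passes from consecutive terms to all pairs.\<close>

lemma countable_sparse_subset:
  assumes countable: "\<not> small (UNIV :: nat set)"
    and A: "A \<subseteq> L" "infinite A"
    and hit_right: "\<And>a c c'. hit a c \<Longrightarrow> c \<preceq> c' \<Longrightarrow> hit a c'"
    and hit_ex: "\<And>a. a \<in> L \<Longrightarrow> \<exists>c\<in>L. hit a c"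
  shows "\<exists>Y\<subseteq>A. infinite Y \<and> (\<forall>a\<in>Y. \<forall>c\<in>Y. a \<prec> c \<longrightarrow> hit a c)"
proof -
  have nsA: "\<not> small A"
    using A countable_small_iff[OF countable] by blast
  have "\<exists>c'\<in>A. c \<prec> c' \<and> hit c c'" if c: "c \<in> A" for c
  proof -
    obtain d where d: "d \<in> L" "hit c d" using hit_ex c A by blast
    obtain b where "b \<in> L" "\<forall>x\<in>{c, d} \<inter> L. x \<prec> b"
      using small_bounded[of "{c, d}"] small_finite[of "{c, d}"] by blast
    moreover obtain c' where "c' \<in> A" "b \<prec> c'"
      using full_size_unbounded[OF nsA A(1) \<open>b \<in> L\<close>] by blast
    ultimately have "c \<prec> b" "d \<preceq> b" "b \<prec> c'" "c' \<in> A"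
      using d c A(1) by blast+
    then show ?thesis
      using d(2) hit_right[of c d c'] le_trans[of _ b c'] le_antisym[of b c] by blast
  qed
  then obtain nx where nx: "\<And>c. c \<in> A \<Longrightarrow> nx c \<in> A \<and> c \<prec> nx c \<and> hit c (nx c)"
    by metis
  obtain b where b: "b \<in> A" using A by fastforce
  define s where "s n = (nx ^^ n) b" for n
  have sA: "s n \<in> A" for n
    by (induction n) (auto simp: s_def b nx)
  have sS: "s n \<prec> s (Suc n) \<and> hit (s n) (s (Suc n))" for n
    using nx[OF sA, of n] by (simp add: s_def)
  have s_less: "s m \<prec> s n" if "m < n" for m n
    using that
  proof (induction n)
    case (Suc n)
    then show ?case
      using sS[of n] le_trans le_antisym by (metis less_Suc_eq)
  qed simp
  then have s_le: "s m \<preceq> s n" if "m \<le> n" for m n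
    using that le_refl sA A by (metis le_neq_implies_less subsetD)
  have "inj s"
    using s_less by (metis injI linorder_neqE_nat)
  then have "infinite (range s)"
    by (simp add: finite_image_iff)
  moreover have "hit (s m) (s n)" if "s m \<prec> s n" for m n
  proof -
    have "m < n"
      using that s_le[of n m] le_antisym by (meson not_le)
    then show ?thesis
      using sS[of m] s_le[of "Suc m" n] hit_right by (metis Suc_leI)
  qed
  ultimately show ?thesis
    using sA by (intro exI[of _ "range s"]) auto
qed

text \<open>Read \<open>hit \<alpha> a c\<close> as \<open>f \<alpha> a \<prec> c\<close>. In the
  sets \<open>C \<alpha>\<close>, any later element exceeds \<open>f \<alpha>\<close> of any earlier
  one. A pseudointersection \<open>A\<close> has this property for each \<open>\<alpha>\<close>
  beyond a bound depending on \<open>\<alpha>\<close>, so \<open>g\<close> can jump along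
  \<open>A\<close>.\<close>

lemma dominating:
  assumes no_tower: "\<And>T. tower L T \<Longrightarrow> \<not> |T| \<le>o K"
    and hit_left: "\<And>\<alpha> a a' c. \<alpha> \<in> Field K \<Longrightarrow> a \<preceq> a' \<Longrightarrow> hit \<alpha> a' c \<Longrightarrow> hit \<alpha> a c"
    and hit_right: "\<And>\<alpha> a c c'. \<alpha> \<in> Field K \<Longrightarrow> hit \<alpha> a c \<Longrightarrow> c \<preceq> c' \<Longrightarrow> hit \<alpha> a c'"
    and hit_ex: "\<And>\<alpha> a. \<alpha> \<in> Field K \<Longrightarrow> a \<in> L \<Longrightarrow> \<exists>c\<in>L. hit \<alpha> a c"
    and hit_chain: "\<And>\<alpha> \<beta>. \<beta> \<in> Field K \<Longrightarrow> \<alpha> \<in> underS K \<beta> \<Longrightarrow>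
          \<exists>b\<in>L. \<forall>a c. b \<preceq> a \<longrightarrow> hit \<beta> a c \<longrightarrow> hit \<alpha> a c"
  shows "\<exists>g. \<forall>\<alpha>\<in>Field K. small {a \<in> L. \<not> hit \<alpha> a (g a)}"
proof -
  have "\<exists>C. \<forall>\<alpha>\<in>Field K. C \<alpha> \<subseteq> L \<and> \<not> small (C \<alpha>) \<and>
      (\<forall>a\<in>C \<alpha>. \<forall>c\<in>C \<alpha>. a \<prec> c \<longrightarrow> hit \<alpha> a c) \<and> (\<forall>\<beta>\<in>underS K \<alpha>. small (C \<alpha> - C \<beta>))"
  proof (cases "small (UNIV :: nat set)")
    case True
    define C where "C \<alpha> = {c \<in> L. \<forall>a. a \<prec> c \<longrightarrow> hit \<alpha> a c}" for \<alpha>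
    have "\<not> small (C \<alpha>)" if "\<alpha> \<in> Field K" for \<alpha>
      unfolding C_def
      by (rule closure_points_not_small[OF True])
        (use that hit_left hit_right hit_ex in blast)+
    moreover have "small (C \<beta> - C \<alpha>)" if \<beta>: "\<beta> \<in> Field K" and \<alpha>: "\<alpha> \<in> underS K \<beta>" for \<alpha> \<beta>
    proof -
      have \<alpha>K: "\<alpha> \<in> Field K"
        using \<alpha> by (auto simp: underS_def Field_def)
      obtain b where b: "b \<in> L" "\<And>a c. b \<preceq> a \<Longrightarrow> hit \<beta> a c \<Longrightarrow> hit \<alpha> a c"
        using hit_chain[OF \<beta> \<alpha>] by blast
      \<comment> \<open>Beyond \<open>d\<close>, all of \<open>C \<beta>\<close> lies in
        \<open>C \<alpha>\<close>: for \<open>a \<preceq> b\<close> the point \<open>d\<close>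
        already gives the hit, and for larger \<open>a\<close> hits for \<open>\<beta>\<close> are
        hits for \<open>\<alpha>\<close>.\<close>
      obtain d where d: "d \<in> L" "hit \<alpha> b d"
        using hit_ex[OF \<alpha>K b(1)] by blast
      have "c \<preceq> d" if c: "c \<in> C \<beta> - C \<alpha>" for c
      proof (rule ccontr)
        assume "\<not> c \<preceq> d"
        then have dc: "d \<preceq> c"
          using le_total[of c d] c d by (auto simp: C_def)
        obtain a where a: "a \<prec> c" "\<not> hit \<alpha> a c" "hit \<beta> a c"
          using c by (auto simp: C_def)
        then have "a \<preceq> b"
          using b le_total[of a b] le_dom[of a c] by blast
        then show False
          using hit_left[OF \<alpha>K _ d(2)] hit_right[OF \<alpha>K _ dc] a by blast
      qed
      then show ?thesis
        by (intro small_mono[OF _ small_below[of d]]) blast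
    qed
    ultimately show ?thesis
      by (intro exI[of _ C]) (auto simp: C_def)
  next
    case False
    note sf = countable_small_iff[OF False]
    \<comment> \<open>The recursion runs over the whole type, so \<open>P\<close> is made vacuous
      off \<open>Field K\<close>.\<close>
    define P where "P C \<alpha> Y \<longleftrightarrow> (\<alpha> \<in> Field K \<longrightarrow> Y \<subseteq> L \<and> infinite Y \<and>
      (\<forall>a\<in>Y. \<forall>c\<in>Y. a \<prec> c \<longrightarrow> hit \<alpha> a c) \<and> (\<forall>\<beta>\<in>underS K \<alpha>. finite (Y - C \<beta>)))"
      for C :: "'a set \<Rightarrow> 'a set" and \<alpha> Y
    have "\<exists>C. \<forall>\<alpha>. P C \<alpha> (C \<alpha>)"
    proof (rule dependent_wf_choice)
      show "wf (K - Id)"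
        using wo_rel.WF[OF wo_K] .
      show "P f x r = P g x r" if "\<And>z. (z, x) \<in> K - Id \<Longrightarrow> f z = g z" for f g x r
        using that by (auto simp: P_def underS_def)
    next
      fix \<alpha> C assume IH: "\<And>\<beta>. (\<beta>, \<alpha>) \<in> K - Id \<Longrightarrow> P C \<beta> (C \<beta>)"
      show "\<exists>Y. P C \<alpha> Y"
      proof (cases "\<alpha> \<in> Field K")
        case True
        have uF: "underS K \<alpha> \<subseteq> Field K"
          by (auto simp: underS_def Field_def)
        have IH': "P C \<beta> (C \<beta>)" "\<beta> \<in> Field K" if "\<beta> \<in> underS K \<alpha>" for \<beta>
          using that IH uF by (auto simp: underS_def)
        \<comment> \<open>The sets chosen so far decrease along an initial segment. Its small
          subsets are finite, so each nonempty one has a largest element, as \<open>bdd\<close>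
          requires.\<close>
        have "\<exists>A. A \<subseteq> L \<and> \<not> small A \<and> (\<forall>\<beta>\<in>underS K \<alpha>. small (A - C \<beta>))"
        proof (rule chain_pseudointersection[OF no_tower uF])
          show "full_size L (C \<beta>)" if "\<beta> \<in> underS K \<alpha>" for \<beta>
            using IH'[OF that] by (auto simp: P_def full_size_iff sf)
          show "small (C \<beta> - C \<gamma>)" if "\<gamma> \<in> underS K \<alpha>" "\<beta> \<in> underS K \<alpha>" "\<gamma> \<in> underS K \<beta>" for \<gamma> \<beta>
            using IH'[OF that(2)] that(3) by (auto simp: P_def sf)
        next
          fix J assume J: "J \<subseteq> underS K \<alpha>" "J \<noteq> {}" "small J"
          then have "finite J" using sf by blast
          from this J(2,1) show "\<exists>\<gamma>\<in>underS K \<alpha>. \<forall>\<beta>\<in>J. (\<beta>, \<gamma>) \<in> K"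
          proof (induction rule: finite_ne_induct)
            case (singleton x)
            then show ?case
              using K_refl uF by auto
          next
            case (insert x F)
            then obtain \<gamma> where \<gamma>: "\<gamma> \<in> underS K \<alpha>" "\<forall>\<beta>\<in>F. (\<beta>, \<gamma>) \<in> K"
              by auto
            have x: "x \<in> underS K \<alpha>" "x \<in> Field K" "\<gamma> \<in> Field K"
              using insert.prems \<gamma> uF by auto
            then consider "(x, \<gamma>) \<in> K" | "(\<gamma>, x) \<in> K"
              using wo_rel.TOTALS[OF wo_K] by blast
            then show ?case
            proof cases
              case 2
              then have "\<forall>\<beta>\<in>insert x F. (\<beta>, x) \<in> K"
                using \<gamma> K_refl x wo_rel.TRANS[OF wo_K] by (auto dest: transD)
              then show ?thesis using x by blast
            qed (use \<gamma> in blast)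
          qed
        qed
        then obtain A where A: "A \<subseteq> L" "infinite A" "\<forall>\<beta>\<in>underS K \<alpha>. finite (A - C \<beta>)"
          using sf by auto
        obtain Y where Y: "Y \<subseteq> A" "infinite Y" "\<forall>a\<in>Y. \<forall>c\<in>Y. a \<prec> c \<longrightarrow> hit \<alpha> a c"
          using countable_sparse_subset[OF False A(1,2), of "hit \<alpha>"] hit_right[OF True] hit_ex[OF True]
          by blast
        have "finite (Y - C \<beta>)" if "\<beta> \<in> underS K \<alpha>" for \<beta>
          using A(3) that Y(1) by (meson Diff_mono finite_subset subset_refl)
        then have "P C \<alpha> Y"
          using Y A(1) unfolding P_def by blast
        then show ?thesis ..
      qed (simp add: P_def)
    qed
    then obtain C where "\<forall>\<alpha>. P C \<alpha> (C \<alpha>)" ..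
    then show ?thesis
      unfolding P_def sf by (intro exI[of _ C]) simp
  qed
  then obtain C where CL: "\<And>\<alpha>. \<alpha> \<in> Field K \<Longrightarrow> C \<alpha> \<subseteq> L \<and> \<not> small (C \<alpha>)"
    and sparse: "\<And>\<alpha> a c. \<alpha> \<in> Field K \<Longrightarrow> a \<in> C \<alpha> \<Longrightarrow> c \<in> C \<alpha> \<Longrightarrow> a \<prec> c \<Longrightarrow> hit \<alpha> a c"
    and decr: "\<And>\<alpha> \<beta>. \<alpha> \<in> Field K \<Longrightarrow> \<beta> \<in> underS K \<alpha> \<Longrightarrow> small (C \<alpha> - C \<beta>)"
    by metis
  have "\<exists>A. A \<subseteq> L \<and> \<not> small A \<and> (\<forall>\<alpha>\<in>Field K. small (A - C \<alpha>))"
  proof (rule chain_pseudointersection[OF no_tower subset_refl])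
    show "full_size L (C \<alpha>)" if "\<alpha> \<in> Field K" for \<alpha>
      using CL[OF that] by (simp add: full_size_iff)
  qed (use decr K_bounded in blast)+
  then obtain A where A: "A \<subseteq> L" "\<not> small A" "\<And>\<alpha>. \<alpha> \<in> Field K \<Longrightarrow> small (A - C \<alpha>)"
    by blast
  \<comment> \<open>Since \<open>a\<close> need not lie in \<open>A\<close>, the jump passes through
    some \<open>a'\<close> in \<open>A\<close>: sparseness applies to \<open>a'\<close> and
    \<open>g a\<close>, and \<open>hit_left\<close> returns to \<open>a\<close>.\<close>
  have "\<exists>c. \<exists>a'\<in>A. c \<in> A \<and> a \<preceq> a' \<and> a' \<prec> c" if "a \<in> L" for a
    using full_size_unbounded[OF A(2,1)] that A(1) by (meson subsetD)
  then obtain g where g: "\<And>a. a \<in> L \<Longrightarrow> \<exists>a'\<in>A. g a \<in> A \<and> a \<preceq> a' \<and> a' \<prec> g a"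
    by metis
  have "small {a \<in> L. \<not> hit \<alpha> a (g a)}" if \<alpha>: "\<alpha> \<in> Field K" for \<alpha>
  proof -
    obtain b where b: "b \<in> L" "\<forall>x\<in>(A - C \<alpha>) \<inter> L. x \<prec> b"
      using small_bounded[OF A(3)[OF \<alpha>]] by blast
    have "a \<preceq> b" if a: "a \<in> L" "\<not> hit \<alpha> a (g a)" for a
    proof (rule ccontr)
      assume n: "\<not> a \<preceq> b"
      obtain a' where a': "a' \<in> A" "g a \<in> A" "a \<preceq> a'" "a' \<prec> g a"
        using g a by blast
      have "\<not> a' \<preceq> b" "\<not> g a \<preceq> b"
        using n a' le_trans[of a] by blast+
      then have "a' \<in> C \<alpha>" "g a \<in> C \<alpha>"
        using a' b A(1) by blast+
      then show False
        using sparse[OF \<alpha>, of a' "g a"] a' hit_left[OF \<alpha>, of a a' "g a"] a by blast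
    qed
    then show ?thesis
      by (intro small_mono[OF _ small_below[of b]]) blast
  qed
  then show ?thesis by blast
qed

section \<open>Coherent index sets of size less than \<open>\<lambda>\<close>\<close>

text \<open>The sets \<open>B \<alpha> \<xi>\<close> of fewer than \<open>\<lambda>\<close> indices grow with \<open>\<xi>\<close> and, for large \<open>\<xi>\<close>, with \<open>\<alpha>\<close>:
  \<open>B \<alpha> \<xi>\<close> consists of the indices reachable from \<open>\<alpha>\<close> by descending steps, where a step from \<open>\<beta>\<close>
  leads to one of its predecessors numbered at most \<open>\<xi>\<close> in a fixed injection of \<open>\<beta>\<close> into \<open>\<lambda>\<close>.\<close>

lemma coherent_small_sets:
  obtains B :: "'a set \<Rightarrow> 'a \<Rightarrow> 'a set set"
  where "\<And>\<alpha> \<xi>. \<alpha> \<in> Field K \<Longrightarrow> B \<alpha> \<xi> \<subseteq> Field K \<and> small (B \<alpha> \<xi>) \<and> \<alpha> \<in> B \<alpha> \<xi>"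
    and "\<And>\<alpha> \<xi> \<zeta>. \<xi> \<preceq> \<zeta> \<Longrightarrow> B \<alpha> \<xi> \<subseteq> B \<alpha> \<zeta>"
    and "\<And>\<alpha> \<beta>. \<beta> \<in> Field K \<Longrightarrow> \<alpha> \<in> underS K \<beta> \<Longrightarrow> \<exists>b\<in>L. \<forall>\<xi>. b \<preceq> \<xi> \<longrightarrow> B \<alpha> \<xi> \<subseteq> B \<beta> \<xi>"
proof -
  have "\<exists>j. inj_on j (underS K \<alpha>) \<and> j ` underS K \<alpha> \<subseteq> L" if "\<alpha> \<in> Field K" for \<alpha>
    using underS_K_le[OF that] card_of_ordLeq by blast
  then obtain j where j: "\<And>\<alpha>. \<alpha> \<in> Field K \<Longrightarrow> inj_on (j \<alpha>) (underS K \<alpha>) \<and> j \<alpha> ` underS K \<alpha> \<subseteq> L"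
    by metis
  define R where "R \<xi> = {(\<alpha>, \<beta>). \<alpha> \<in> Field K \<and> \<beta> \<in> underS K \<alpha> \<and> j \<alpha> \<beta> \<preceq> \<xi>}" for \<xi>
  define B where "B \<alpha> \<xi> = {\<beta>. (\<alpha>, \<beta>) \<in> (R \<xi>)\<^sup>*}" for \<alpha> \<xi>
  show thesis
  proof
    show "B \<alpha> \<xi> \<subseteq> Field K \<and> small (B \<alpha> \<xi>) \<and> \<alpha> \<in> B \<alpha> \<xi>" if "\<alpha> \<in> Field K" for \<alpha> \<xi>
    proof (intro conjI)
      show "B \<alpha> \<xi> \<subseteq> Field K"
      proof
        fix \<beta> assume "\<beta> \<in> B \<alpha> \<xi>"
        then have "(\<alpha>, \<beta>) \<in> (R \<xi>)\<^sup>*" by (simp add: B_def)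
        then show "\<beta> \<in> Field K"
          by induction (use that in \<open>auto simp: R_def underS_def Field_def\<close>)
      qed
      show "\<alpha> \<in> B \<alpha> \<xi>" by (simp add: B_def)
      have "wf (K - Id)"
        using wo_rel.WF[OF wo_K] .
      then show "small (B \<alpha> \<xi>)" using that
      proof (induction \<alpha> rule: wf_induct_rule)
        case (less \<alpha>)
        \<comment> \<open>A path from \<open>\<alpha>\<close> is trivial or starts with a step into
          \<open>?N\<close>, which \<open>j \<alpha>\<close> injects into the initial segment up to
          \<open>\<xi>\<close>.\<close>
        let ?N = "{\<beta>. (\<alpha>, \<beta>) \<in> R \<xi>}"
        have "inj_on (j \<alpha>) ?N" "j \<alpha> ` ?N \<subseteq> {x. x \<preceq> \<xi>}"
          using j[OF less.prems] by (auto simp: R_def inj_on_def)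
        then have "small ?N"
          using ordLeq_ordLess_trans[OF _ small_below[of \<xi>]] card_of_ordLeq[of ?N "{x. x \<preceq> \<xi>}"]
          by blast
        moreover have "small (B \<beta> \<xi>)" if "\<beta> \<in> ?N" for \<beta>
          using that less.IH by (auto simp: R_def underS_def Field_def)
        ultimately have "small ({\<alpha>} \<union> (\<Union>\<beta>\<in>?N. B \<beta> \<xi>))"
          by (intro small_Un small_UN small_finite[of "{\<alpha>}"]) auto
        moreover have "B \<alpha> \<xi> \<subseteq> {\<alpha>} \<union> (\<Union>\<beta>\<in>?N. B \<beta> \<xi>)"
          unfolding B_def by (auto elim: converse_rtranclE)
        ultimately show ?case
          using small_mono[of "B \<alpha> \<xi>"] by blast
      qed
    qed
    show "B \<alpha> \<xi> \<subseteq> B \<alpha> \<zeta>" if "\<xi> \<preceq> \<zeta>" for \<alpha> \<xi> \<zeta>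
    proof -
      have "R \<xi> \<subseteq> R \<zeta>" using that le_trans by (auto simp: R_def)
      then show ?thesis using rtrancl_mono unfolding B_def by blast
    qed
    show "\<exists>b\<in>L. \<forall>\<xi>. b \<preceq> \<xi> \<longrightarrow> B \<alpha> \<xi> \<subseteq> B \<beta> \<xi>" if "\<beta> \<in> Field K" "\<alpha> \<in> underS K \<beta>" for \<alpha> \<beta>
    proof (intro bexI allI impI)
      \<comment> \<open>Once \<open>\<xi>\<close> reaches this number, \<open>\<alpha>\<close> is
        one step from \<open>\<beta>\<close>, and paths from \<open>\<alpha>\<close> extend to paths
        from \<open>\<beta>\<close>.\<close>
      show "j \<beta> \<alpha> \<in> L" using j that by blast
      show "B \<alpha> \<xi> \<subseteq> B \<beta> \<xi>" if "j \<beta> \<alpha> \<preceq> \<xi>" for \<xi>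
      proof -
        have "(\<beta>, \<alpha>) \<in> R \<xi>"
          using that \<open>\<beta> \<in> Field K\<close> \<open>\<alpha> \<in> underS K \<beta>\<close> by (simp add: R_def)
        then show ?thesis
          by (auto simp: B_def intro: converse_rtrancl_into_rtrancl)
      qed
    qed
  qed
qed

section \<open>A tower from a family without pseudointersection\<close>

lemma tower_of_p_family:
  assumes F: "p_family L F" "|F| =o K"
  shows "\<exists>T. tower L T \<and> |T| \<le>o K"
proof (rule ccontr)
  assume "\<not> ?thesis"
  then have no_tower: "\<And>T. tower L T \<Longrightarrow> \<not> |T| \<le>o K" by blast
  have sip: "\<And>A. A \<in> F \<Longrightarrow> full_size L A"
    "\<And>F'. F' \<subseteq> F \<Longrightarrow> F' \<noteq> {} \<Longrightarrow> small F' \<Longrightarrow> |\<Inter>F'| =o |L|"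
    and no_psi: "\<And>A. full_size L A \<Longrightarrow> \<exists>X\<in>F. \<not> small (A - X)"
    using F(1) unfolding p_family_def strong_intersection_property_def pseudointersection_def almost_sub_def
    by blast+
  have "|Field K| =o |F|"
    using F(2) Field_K_ordIso ordIso_symmetric ordIso_transitive by blast
  then obtain E where E: "bij_betw E (Field K) F"
    using card_of_ordIso by blast
  obtain B where B: "\<And>\<alpha> \<xi>. \<alpha> \<in> Field K \<Longrightarrow> B \<alpha> \<xi> \<subseteq> Field K \<and> small (B \<alpha> \<xi>) \<and> \<alpha> \<in> B \<alpha> \<xi>"
    and B_mono: "\<And>\<alpha> \<xi> \<zeta>. \<xi> \<preceq> \<zeta> \<Longrightarrow> B \<alpha> \<xi> \<subseteq> B \<alpha> \<zeta>"
    and B_chain: "\<And>\<alpha> \<beta>. \<beta> \<in> Field K \<Longrightarrow> \<alpha> \<in> underS K \<beta> \<Longrightarrow> \<exists>b\<in>L. \<forall>\<xi>. b \<preceq> \<xi> \<longrightarrow> B \<alpha> \<xi> \<subseteq> B \<beta> \<xi>"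
    using coherent_small_sets by metis
  define S where "S \<alpha> \<xi> = {x. \<xi> \<preceq> x \<and> x \<in> (\<Inter>\<beta>\<in>B \<alpha> \<xi>. E \<beta>)}" for \<alpha> \<xi>
  \<comment> \<open>This expresses that the minimum of \<open>S \<alpha> a\<close> is below
    \<open>c\<close>, without choosing that minimum.\<close>
  define hit where "hit \<alpha> a c \<longleftrightarrow> (\<exists>x\<in>S \<alpha> a. x \<prec> c)" for \<alpha> a c
  have S_ne: "S \<alpha> \<xi> \<noteq> {}" if \<alpha>: "\<alpha> \<in> Field K" and \<xi>: "\<xi> \<in> L" for \<alpha> \<xi>
  proof -
    have EB: "E ` B \<alpha> \<xi> \<subseteq> F" "E ` B \<alpha> \<xi> \<noteq> {}" "small (E ` B \<alpha> \<xi>)"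
      using B[OF \<alpha>, of \<xi>] E small_image by (auto simp: bij_betw_def)
    then have "full_size L (\<Inter>\<beta>\<in>B \<alpha> \<xi>. E \<beta>)"
      using sip unfolding full_size_def by (metis Inter_subset subset_iff)
    then show ?thesis
      using full_size_unbounded[OF _ _ \<xi>] unfolding full_size_iff S_def by blast
  qed
  have S_antimono: "S \<alpha> \<zeta> \<subseteq> S \<alpha> \<xi>" if "\<xi> \<preceq> \<zeta>" for \<alpha> \<xi> \<zeta>
    using B_mono[OF that, of \<alpha>] that le_trans by (auto simp: S_def)
  have S_chain: "\<exists>b\<in>L. \<forall>\<xi>. b \<preceq> \<xi> \<longrightarrow> S \<beta> \<xi> \<subseteq> S \<alpha> \<xi>"
    if \<beta>: "\<beta> \<in> Field K" "\<alpha> \<in> underS K \<beta>" for \<alpha> \<beta>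
  proof -
    obtain b where "b \<in> L" "\<forall>\<xi>. b \<preceq> \<xi> \<longrightarrow> B \<alpha> \<xi> \<subseteq> B \<beta> \<xi>"
      using B_chain[OF \<beta>] by blast
    then show ?thesis unfolding S_def by blast
  qed
  have "\<exists>g. \<forall>\<alpha>\<in>Field K. small {a \<in> L. \<not> hit \<alpha> a (g a)}"
  proof (rule dominating[OF no_tower])
    show "hit \<alpha> a c" if "a \<preceq> a'" "hit \<alpha> a' c" for \<alpha> a a' c
      using that S_antimono[of a a' \<alpha>] unfolding hit_def by blast
    show "hit \<alpha> a c'" if "hit \<alpha> a c" "c \<preceq> c'" for \<alpha> a c c'
      using that le_trans[of _ c c'] le_antisym[of _ c] unfolding hit_def by blast
    show "\<exists>c\<in>L. hit \<alpha> a c" if \<alpha>: "\<alpha> \<in> Field K" and a: "a \<in> L" for \<alpha> a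
    proof -
      obtain x where x: "x \<in> S \<alpha> a" using S_ne[OF \<alpha> a] by blast
      then have "x \<in> L" using le_dom by (auto simp: S_def)
      then show ?thesis
        using x full_size_unbounded[OF not_small_L subset_refl] unfolding hit_def by blast
    qed
    show "\<exists>b\<in>L. \<forall>a c. b \<preceq> a \<longrightarrow> hit \<beta> a c \<longrightarrow> hit \<alpha> a c"
      if "\<beta> \<in> Field K" "\<alpha> \<in> underS K \<beta>" for \<alpha> \<beta>
      using S_chain[OF that] unfolding hit_def by blast
  qed
  then obtain g where g: "\<And>\<alpha>. \<alpha> \<in> Field K \<Longrightarrow> small {a \<in> L. \<not> hit \<alpha> a (g a)}"
    by blast
  define T where "T \<alpha> = (\<Union>\<xi>\<in>L. {x \<in> S \<alpha> \<xi>. x \<prec> g \<xi>})" for \<alpha>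
  have TL: "T \<alpha> \<subseteq> L" for \<alpha>
    using le_dom by (auto simp: T_def)
  have "\<exists>A. A \<subseteq> L \<and> \<not> small A \<and> (\<forall>\<alpha>\<in>Field K. small (A - T \<alpha>))"
  proof (rule chain_pseudointersection[OF no_tower subset_refl])
    fix \<alpha> assume \<alpha>: "\<alpha> \<in> Field K"
    have "\<not> small (T \<alpha>)"
    proof (rule unbounded_not_small)
      fix b assume b: "b \<in> L"
      \<comment> \<open>From \<open>b'\<close> on, \<open>g a\<close> exceeds some element of
        \<open>S \<alpha> a\<close>, and all elements of that set are at least
        \<open>a\<close>.\<close>
      obtain b' where b': "b' \<in> L" "\<forall>x\<in>{a \<in> L. \<not> hit \<alpha> a (g a)} \<inter> L. x \<prec> b'"
        using small_bounded[OF g[OF \<alpha>]] by blast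
      obtain a where a: "a \<in> L" "b \<preceq> a" "b' \<preceq> a"
        using b b'(1) le_total[of b b'] le_refl by blast
      then have "hit \<alpha> a (g a)"
        using b'(2) le_antisym[of a b'] by blast
      then obtain x where "x \<in> S \<alpha> a" "x \<prec> g a"
        unfolding hit_def by blast
      then show "\<exists>a\<in>T \<alpha>. b \<preceq> a"
        using a le_trans[of b a x] by (auto simp: T_def S_def)
    qed
    then show "full_size L (T \<alpha>)"
      using TL full_size_iff by blast
  next
    fix \<alpha> \<beta> assume "\<alpha> \<in> Field K" and \<beta>: "\<beta> \<in> Field K" "\<alpha> \<in> underS K \<beta>"
    obtain b where b: "b \<in> L" "\<And>\<xi>. b \<preceq> \<xi> \<Longrightarrow> S \<beta> \<xi> \<subseteq> S \<alpha> \<xi>"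
      using S_chain[OF \<beta>] by blast
    \<comment> \<open>Only indices \<open>\<xi> \<preceq> b\<close> can contribute to the
      difference, each a set bounded by \<open>g \<xi>\<close>. By regularity the union is
      small.\<close>
    have "T \<beta> - T \<alpha> \<subseteq> (\<Union>\<xi>\<in>{x. x \<preceq> b}. {x. x \<preceq> g \<xi>})"
      using b le_total[OF b(1)] by (fastforce simp: T_def)
    then show "small (T \<beta> - T \<alpha>)"
      using small_UN[OF small_below[of b] small_below] small_mono by blast
  qed (assumption | rule K_bounded)+
  then obtain A where A: "A \<subseteq> L" "\<not> small A" "\<And>\<alpha>. \<alpha> \<in> Field K \<Longrightarrow> small (A - T \<alpha>)"
    by blast
  obtain X where X: "X \<in> F" "\<not> small (A - X)"
    using no_psi A full_size_iff by blast
  then obtain \<alpha> where \<alpha>: "\<alpha> \<in> Field K" "E \<alpha> = X"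
    using E by (auto simp: bij_betw_def)
  \<comment> \<open>Since \<open>\<alpha> \<in> B \<alpha> \<xi>\<close>, every
    \<open>S \<alpha> \<xi>\<close> is contained in \<open>E \<alpha>\<close>.\<close>
  have "T \<alpha> \<subseteq> X"
    using B[OF \<alpha>(1)] \<alpha>(2) by (auto simp: T_def S_def)
  then show False
    using A(3)[OF \<alpha>(1)] X(2) small_mono[of "A - X" "A - T \<alpha>"] by blast
qed

end

theorem mainTheorem1:
  fixes L :: "'a set"
  assumes "infinite L"
    and "lambda_lt_lambda_eq L"
    and "p_lambda_is L (cardSuc (card_of L))"
  shows "t_lambda_is L (cardSuc (card_of L))"
proof -
  interpret lambda_power L
    using assms by unfold_locales
  \<comment> \<open>A tower is in particular a \<open>p_family\<close>, so the lower bound on the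
    size of such families applies to it.\<close>
  have minimal: "\<not> |T| <o cardSuc |L|" if "tower L T" for T
    using assms(3) that unfolding least_card_is_def tower_def by blast
  obtain T where "tower L T" "|T| \<le>o cardSuc |L|"
    using assms(3) tower_of_p_family unfolding least_card_is_def by blast
  then have "tower L T \<and> |T| =o cardSuc |L|"
    using minimal ordLeq_iff_ordLess_or_ordIso by blast
  then show ?thesis
    using minimal unfolding least_card_is_def by blast
qed

end
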